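(* Let $E$ be a complex Banach space, let $I=\mathbb{R}$ or $I=[0,\infty)$, and let $f\in C_b(I:E)$. (i) If $f$ is anti-periodic, then $f$ is semi-anti-periodic. (ii) If $f$ is semi-anti-periodic, then $f$ is semi-periodic and almost anti-periodic.
   Context: $C_b(I:E)$ is the space of bounded continuous functions $I\to E$. Set $\mathbb{S}:=\mathbb{N}$ if $I=[0,\infty)$ and $\mathbb{S}:=\mathbb{Z}$ if $I=\mathbb{R}$. A function $f:I\to E$ is anti-periodic if there exists $p>0$ such that $f(x+p)=-f(x)$ for all $x\in I$. A function $f\in C_b(I:E)$ is semi-anti-periodic if for every $\varepsilon>0$ there exists $p>0$ such that for all $m\in\mathbb{S}$ and all $x\in I$ one has $\|f(x+mp)-(-1)^m f(x)\|\le\varepsilon$. A function $f\in C_b(I:E)$ is semi-periodic if for every $\varepsilon>0$ there exists $p>0$ such that for all $m\in\mathbb{S}$ and all $x\in I$ one has $\|f(x+mp)-f(x)\|\le\varepsilon$. For $\varepsilon>0$, a number $\tau>0$ is an $\varepsilon$-antiperiod of a continuous function $f:I\to E$ if $\|f(t+\tau)+f(t)\|\le\varepsilon$ for all $t\in I$. The function $f$ is almost anti-periodic if for each $\varepsilon>0$ the set of all $\varepsilon$-antiperiods of $f$ is relatively dense in $[0,\infty)$, i.e. there exists $l>0$ such that every subinterval of $[0,\infty)$ of length $l$ meets this set. *)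

theory Defs
  imports "HOL-Analysis.Analysis"
begin

text \<open>Complex Banach spaces: a Banach space whose real scalar multiplication is the restriction
  of a complex one, with absolutely homogeneous norm. The law \<open>1 *\<^sub>C x = x\<close> follows from
  \<open>scaleC_of_real\<close>.\<close>

class complex_banach = banach +
  fixes scaleC :: "complex \<Rightarrow> 'a \<Rightarrow> 'a"  (infixr "*\<^sub>C" 75)
  assumes scaleC_add_right: "c *\<^sub>C (x + y) = c *\<^sub>C x + c *\<^sub>C y"
    and scaleC_add_left: "(c + d) *\<^sub>C x = c *\<^sub>C x + d *\<^sub>C x"
    and scaleC_scaleC: "c *\<^sub>C (d *\<^sub>C x) = (c * d) *\<^sub>C x"
    and scaleC_of_real: "complex_of_real r *\<^sub>C x = r *\<^sub>R x"
    and norm_scaleC: "norm (c *\<^sub>C x) = cmod c * norm x"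

instantiation complex :: complex_banach
begin

definition scaleC_complex :: "complex \<Rightarrow> complex \<Rightarrow> complex"
  where "scaleC_complex c x = c * x"

instance
  by standard (simp_all add: scaleC_complex_def algebra_simps norm_mult scaleR_conv_of_real)

end

text \<open>A function \<open>I \<rightarrow> E\<close> is represented by a total function \<open>real \<Rightarrow> 'a\<close> of which only the
  values on \<open>I\<close> matter; \<open>I\<close> is meant to be \<open>UNIV\<close> or \<open>{0..}\<close>.\<close>

definition C_b :: "real set \<Rightarrow> (real \<Rightarrow> 'a::complex_banach) set"
  where "C_b I = {f. continuous_on I f \<and> bounded (f ` I)}"

text \<open>The index set of the multiples of a period: the positive integers for the half-line and all
  integers for the line. Whether 0 is counted is immaterial, since the conditions below
  are trivial for \<open>m = 0\<close>.\<close>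

definition multipliers :: "real set \<Rightarrow> int set"
  where "multipliers I = (if I = {0..} then {1..} else UNIV)"

definition anti_periodic :: "real set \<Rightarrow> (real \<Rightarrow> 'a::complex_banach) \<Rightarrow> bool"
  where "anti_periodic I f \<longleftrightarrow> (\<exists>p>0. \<forall>x\<in>I. f (x + p) = - f x)"

definition semi_anti_periodic :: "real set \<Rightarrow> (real \<Rightarrow> 'a::complex_banach) \<Rightarrow> bool"
  where "semi_anti_periodic I f \<longleftrightarrow> f \<in> C_b I \<and>
    (\<forall>\<epsilon>>0. \<exists>p>0. \<forall>m\<in>multipliers I. \<forall>x\<in>I.
       norm (f (x + of_int m * p) - ((-1) powi m) *\<^sub>R f x) \<le> \<epsilon>)"

definition semi_periodic :: "real set \<Rightarrow> (real \<Rightarrow> 'a::complex_banach) \<Rightarrow> bool"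
  where "semi_periodic I f \<longleftrightarrow> f \<in> C_b I \<and>
    (\<forall>\<epsilon>>0. \<exists>p>0. \<forall>m\<in>multipliers I. \<forall>x\<in>I. norm (f (x + of_int m * p) - f x) \<le> \<epsilon>)"

definition antiperiods :: "real set \<Rightarrow> (real \<Rightarrow> 'a::complex_banach) \<Rightarrow> real \<Rightarrow> real set"
  where "antiperiods I f \<epsilon> = {\<tau>. \<tau> > 0 \<and> (\<forall>t\<in>I. norm (f (t + \<tau>) + f t) \<le> \<epsilon>)}"

definition relatively_dense_nonneg :: "real set \<Rightarrow> bool"
  where "relatively_dense_nonneg A \<longleftrightarrow> (\<exists>l>0. \<forall>a\<ge>0. {a..a + l} \<inter> A \<noteq> {})"

definition almost_anti_periodic :: "real set \<Rightarrow> (real \<Rightarrow> 'a::complex_banach) \<Rightarrow> bool"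
  where "almost_anti_periodic I f \<longleftrightarrow> continuous_on I f \<and>
    (\<forall>\<epsilon>>0. relatively_dense_nonneg (antiperiods I f \<epsilon>))"

end

theory Submission
  imports Defs
begin

text \<open>Iterating \<open>f (x + p) = - f x\<close> gives \<open>f (x + m p) = (-1)\<^sup>m f x\<close> exactly, so an antiperiod
  \<open>p\<close> serves every \<open>\<epsilon>\<close> in the definition of semi-anti-periodicity. Conversely, let \<open>p\<close> be chosen
  for \<open>\<epsilon>\<close> in that definition. The sign \<open>(-1)\<^sup>m\<close> is \<open>1\<close> for even \<open>m\<close> and \<open>-1\<close> for odd \<open>m\<close>. Hence
  the even multiples of \<open>p\<close> show that \<open>2 p\<close> is a semi-period, and the odd positive multiples are
  \<open>\<epsilon>\<close>-antiperiods; the latter are spaced \<open>2 p\<close> apart, hence relatively dense.\<close>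

lemma anti_periodic_nat_multiple:
  fixes f :: "real \<Rightarrow> 'a::real_vector"
  assumes anti: "\<And>x. x \<in> I \<Longrightarrow> f (x + p) = - f x"
    and shift: "\<And>x. x \<in> I \<Longrightarrow> x + p \<in> I"
    and "x \<in> I"
  shows "f (x + real n * p) = (-1) ^ n *\<^sub>R f x"
  using \<open>x \<in> I\<close>
proof (induction n arbitrary: x)
  case 0
  then show ?case by simp
next
  case (Suc n)
  have "f (x + real (Suc n) * p) = f ((x + p) + real n * p)"
    by (simp add: algebra_simps)
  also have "\<dots> = (-1) ^ n *\<^sub>R f (x + p)"
    using Suc shift by blast
  finally show ?case
    using anti[OF Suc.prems] by simp
qed

text \<open>A negative multiple is undone by the positive one: apply the case of natural multiples at
  the point \<open>x - n p\<close>, which is available only on the whole line, and use that \<open>(-1)\<^sup>n\<close> is its own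
  inverse.\<close>

lemma anti_periodic_int_multiple:
  fixes f :: "real \<Rightarrow> 'a::real_vector"
  assumes anti: "\<And>x. f (x + p) = - f x"
  shows "f (x + of_int m * p) = ((-1) powi m) *\<^sub>R f x"
proof (cases "m \<ge> 0")
  case True
  then obtain n where "m = int n"
    using nonneg_int_cases by blast
  then show ?thesis
    using anti_periodic_nat_multiple[of UNIV f p x n] anti by simp
next
  case False
  then obtain n where m: "m = - int n"
    by (metis int_cases2 of_nat_0_le_iff)
  have "f x = (-1) ^ n *\<^sub>R f (x - real n * p)"
    using anti_periodic_nat_multiple[of UNIV f p "x - real n * p" n] anti by simp
  then have "(-1) ^ n *\<^sub>R f x = f (x - real n * p)"
    by (simp flip: power_mult_distrib)
  then show ?thesis
    by (simp add: m power_int_minus flip: power_inverse)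
qed

lemma anti_periodic_imp_semi_anti_periodic:
  assumes I: "I = UNIV \<or> I = {0..}" and "f \<in> C_b I" and "anti_periodic I f"
  shows "semi_anti_periodic I f"
proof -
  obtain p where "p > 0" and anti: "\<And>x. x \<in> I \<Longrightarrow> f (x + p) = - f x"
    using \<open>anti_periodic I f\<close> unfolding anti_periodic_def by blast
  have "f (x + of_int m * p) = ((-1) powi m) *\<^sub>R f x"
    if "m \<in> multipliers I" "x \<in> I" for m x
    using I
  proof
    assume "I = UNIV"
    then show ?thesis
      using anti anti_periodic_int_multiple[of f p x m] by simp
  next
    assume half_line: "I = {0..}"
    then obtain n where "m = int n"
      using \<open>m \<in> multipliers I\<close> nonneg_int_cases[of m] by (auto simp: multipliers_def)
    then show ?thesis
      using anti_periodic_nat_multiple[of I f p x n] anti half_line \<open>p > 0\<close> \<open>x \<in> I\<close> by simp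
  qed
  then show ?thesis
    using \<open>f \<in> C_b I\<close> \<open>p > 0\<close> unfolding semi_anti_periodic_def by force
qed

lemma positive_in_multipliers: "m \<ge> 1 \<Longrightarrow> m \<in> multipliers I"
  by (simp add: multipliers_def)

lemma double_in_multipliers: "m \<in> multipliers I \<Longrightarrow> 2 * m \<in> multipliers I"
  by (auto simp: multipliers_def split: if_splits)

lemma semi_anti_periodic_imp_semi_periodic:
  assumes "semi_anti_periodic I f"
  shows "semi_periodic I f"
  unfolding semi_periodic_def
proof (intro conjI allI impI)
  show "f \<in> C_b I"
    using assms unfolding semi_anti_periodic_def by blast
next
  fix \<epsilon> :: real
  assume "\<epsilon> > 0"
  then obtain p where "p > 0" and semi:
    "\<And>m x. m \<in> multipliers I \<Longrightarrow> x \<in> I \<Longrightarrow>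
       norm (f (x + of_int m * p) - ((-1) powi m) *\<^sub>R f x) \<le> \<epsilon>"
    using assms unfolding semi_anti_periodic_def by blast
  have "norm (f (x + of_int m * (2 * p)) - f x) \<le> \<epsilon>" if "m \<in> multipliers I" "x \<in> I" for m x
  proof -
    have "((-1) powi (2 * m) :: real) = 1"
      by (simp add: power_int_mult)
    moreover have "of_int (2 * m) * p = of_int m * (2 * p)"
      by simp
    ultimately show ?thesis
      using semi[OF double_in_multipliers[OF that(1)] that(2)] by (metis scaleR_one)
  qed
  then show "\<exists>p>0. \<forall>m\<in>multipliers I. \<forall>x\<in>I. norm (f (x + of_int m * p) - f x) \<le> \<epsilon>"
    using \<open>p > 0\<close> by (intro exI[of _ "2 * p"]) simp
qed

lemma relatively_dense_nonneg_odd_multiples: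
  assumes "p > 0" and odd: "\<And>k::int. k \<ge> 0 \<Longrightarrow> of_int (2 * k + 1) * p \<in> A"
  shows "relatively_dense_nonneg A"
  unfolding relatively_dense_nonneg_def
proof (intro exI[of _ "2 * p"] conjI allI impI)
  show "2 * p > 0"
    using \<open>p > 0\<close> by simp
next
  fix a :: real
  assume "a \<ge> 0"
  obtain q where a: "a = q * p" and "q \<ge> 0"
    using \<open>a \<ge> 0\<close> \<open>p > 0\<close> that[of "a / p"] by simp
  \<comment> \<open>The least \<open>k\<close> with \<open>a \<le> (2 k + 1) p\<close>; it is nonnegative since the rounded quantity is at
    least \<open>-1/2\<close>.\<close>
  define k where "k = \<lceil>(q - 1) / 2\<rceil>"
  have k: "of_int k - 1 < (q - 1) / 2" "(q - 1) / 2 \<le> of_int k"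
    using ceiling_correct[of "(q - 1) / 2"] unfolding k_def by simp_all
  have "of_int (- 1) < (of_int k :: real)"
    using k(2) \<open>q \<ge> 0\<close> by simp
  then have "k \<ge> 0"
    unfolding of_int_less_iff by simp
  have "q \<le> of_int (2 * k + 1)" "of_int (2 * k + 1) \<le> q + 2"
    using k by simp_all
  then have "q * p \<le> of_int (2 * k + 1) * p" "of_int (2 * k + 1) * p \<le> (q + 2) * p"
    using \<open>p > 0\<close> by (intro mult_right_mono; simp)+
  then have "a \<le> of_int (2 * k + 1) * p" "of_int (2 * k + 1) * p \<le> a + 2 * p"
    unfolding a by (simp_all add: distrib_right)
  then show "{a..a + 2 * p} \<inter> A \<noteq> {}"
    using odd[OF \<open>k \<ge> 0\<close>] by (metis atLeastAtMost_iff disjoint_iff)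
qed

lemma semi_anti_periodic_imp_almost_anti_periodic:
  assumes "semi_anti_periodic I f"
  shows "almost_anti_periodic I f"
  unfolding almost_anti_periodic_def
proof (intro conjI allI impI)
  show "continuous_on I f"
    using assms unfolding semi_anti_periodic_def C_b_def by blast
next
  fix \<epsilon> :: real
  assume "\<epsilon> > 0"
  then obtain p where "p > 0" and semi:
    "\<And>m x. m \<in> multipliers I \<Longrightarrow> x \<in> I \<Longrightarrow>
       norm (f (x + of_int m * p) - ((-1) powi m) *\<^sub>R f x) \<le> \<epsilon>"
    using assms unfolding semi_anti_periodic_def by blast
  show "relatively_dense_nonneg (antiperiods I f \<epsilon>)"
  proof (rule relatively_dense_nonneg_odd_multiples[OF \<open>p > 0\<close>])
    fix k :: int
    assume "k \<ge> 0"
    then have "of_int (2 * k + 1) * p > 0"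
      using \<open>p > 0\<close> by (intro mult_pos_pos) simp_all
    moreover have "((-1) powi (2 * k + 1) :: real) = -1"
      by (simp add: power_int_add power_int_mult)
    then have "norm (f (t + of_int (2 * k + 1) * p) + f t) \<le> \<epsilon>" if "t \<in> I" for t
      using semi[OF positive_in_multipliers that, of "2 * k + 1"] \<open>k \<ge> 0\<close> by simp
    ultimately show "of_int (2 * k + 1) * p \<in> antiperiods I f \<epsilon>"
      unfolding antiperiods_def by blast
  qed
qed

theorem proposition2p7:
  fixes f :: "real \<Rightarrow> 'a::complex_banach" and I :: "real set"
  assumes "I = UNIV \<or> I = {0..}" and "f \<in> C_b I"
  shows "(anti_periodic I f \<longrightarrow> semi_anti_periodic I f) \<and>
         (semi_anti_periodic I f \<longrightarrow> semi_periodic I f \<and> almost_anti_periodic I f)"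
  using anti_periodic_imp_semi_anti_periodic[OF assms]
    semi_anti_periodic_imp_semi_periodic semi_anti_periodic_imp_almost_anti_periodic
  by blast

end
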